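(* Let $f:\mathbb{R}^n\to\mathbb{R}$ be convex and locally Lipschitz continuous, assume that the set $\Omega^2$ of points at which $f$ is not twice differentiable is a Lebesgue null set, and assume that for all $x\in\mathbb{R}^n$ there is an open set $V\ni x$ such that $\{\nabla^2 f(y): y\in V\setminus\Omega^2\}$ is bounded. Then for every bounded set $U\subseteq\mathbb{R}^n$ and every $\varepsilon'>0$ there is some $K>0$ such that $$\max_{z\in B_\varepsilon(x)} R_{x,\varepsilon}(z)\le K\varepsilon^2\qquad\forall x\in U,\ \varepsilon\in(0,\varepsilon'].$$
   Context: $B_\delta(x)=\{y\in\mathbb{R}^n:\|x-y\|\le\delta\}$ (Euclidean norm). The second-order $\varepsilon$-jet of $f$ at $x$ ($\varepsilon\ge0$) is $$\mathcal{J}^2_\varepsilon f(x)=\bigcap_{\delta>\varepsilon}\overline{\{(y,f(y),\nabla f(y),\nabla^2 f(y)): y\in B_\delta(x)\setminus\Omega^2\}}\subseteq\mathbb{R}^n\times\mathbb{R}\times\mathbb{R}^n\times\mathbb{R}^{n\times n}.$$ The model of $f$ and its error are $$\mathcal{T}_{x,\varepsilon}(z)=\max_{(y,f(y),\xi,\mathcal{H})\in \mathcal{J}^2_\varepsilon f(x)} f(y)+\xi^\top(z-y)+\tfrac12(z-y)^\top\mathcal{H}(z-y),\qquad R_{x,\varepsilon}(z)=\mathcal{T}_{x,\varepsilon}(z)-f(z).$$ *)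

theory Defs
  imports "HOL-Analysis.Analysis"
begin

definition locally_lipschitz :: "('a::metric_space \<Rightarrow> 'b::metric_space) \<Rightarrow> bool" where
  "locally_lipschitz f \<longleftrightarrow> (\<forall>x. \<exists>r>0. \<exists>L. L-lipschitz_on (ball x r) f)"

text \<open>
  The gradient; unspecified at points where \<open>f\<close> is not differentiable.
\<close>
definition grad :: "(real ^ 'n \<Rightarrow> real) \<Rightarrow> real ^ 'n \<Rightarrow> real ^ 'n" where
  "grad f x = (THE g. GDERIV f x :> g)"

text \<open>
  Twice differentiability at a point is meant in the classical sense: \<open>f\<close> is differentiable
  on a neighbourhood of the point, and its gradient is differentiable at the point.
\<close>
definition twice_differentiable_at :: "(real ^ 'n \<Rightarrow> real) \<Rightarrow> real ^ 'n \<Rightarrow> bool" where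
  "twice_differentiable_at f x \<longleftrightarrow>
     (\<forall>\<^sub>F y in nhds x. f differentiable (at y)) \<and> grad f differentiable (at x)"

definition hess :: "(real ^ 'n \<Rightarrow> real) \<Rightarrow> real ^ 'n \<Rightarrow> real ^ 'n ^ 'n" where
  "hess f x = jacobian (grad f) (at x)"

definition Omega2 :: "(real ^ 'n \<Rightarrow> real) \<Rightarrow> (real ^ 'n) set" where
  "Omega2 f = {x. \<not> twice_differentiable_at f x}"

definition jet2 ::
  "(real ^ 'n \<Rightarrow> real) \<Rightarrow> real ^ 'n \<Rightarrow> real \<Rightarrow> ((real ^ 'n) \<times> real \<times> (real ^ 'n) \<times> (real ^ 'n ^ 'n)) set" where
  "jet2 f x \<epsilon> = (\<Inter>\<delta>\<in>{\<epsilon><..}. closure {(y, f y, grad f y, hess f y) | y. y \<in> cball x \<delta> - Omega2 f})"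

definition is_max :: "real set \<Rightarrow> real \<Rightarrow> bool" where
  "is_max S m \<longleftrightarrow> m \<in> S \<and> (\<forall>s\<in>S. s \<le> m)"

text \<open>
  The maximum below is attained whenever the jet is nonempty and compact, in particular when
  \<open>f\<close> is locally Lipschitz, \<open>Omega2 f\<close> is a null set and the Hessian is locally bounded off
  \<open>Omega2 f\<close>; otherwise the value may be unspecified.
\<close>
definition model :: "(real ^ 'n \<Rightarrow> real) \<Rightarrow> real ^ 'n \<Rightarrow> real \<Rightarrow> real ^ 'n \<Rightarrow> real" where
  "model f x \<epsilon> z =
     (THE m. is_max {f y + \<xi> \<bullet> (z - y) + 1/2 * ((z - y) \<bullet> (H *v (z - y))) | y \<xi> H.
                       (y, f y, \<xi>, H) \<in> jet2 f x \<epsilon>} m)"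

definition model_error :: "(real ^ 'n \<Rightarrow> real) \<Rightarrow> real ^ 'n \<Rightarrow> real \<Rightarrow> real ^ 'n \<Rightarrow> real" where
  "model_error f x \<epsilon> z = model f x \<epsilon> z - f z"

end

theory Submission
  imports Defs
begin

text \<open>
  By convexity every gradient, and hence every limit \<open>\<xi>\<close> of gradients at \<open>y\<close>, is a subgradient:
  \<open>f y + \<xi> \<bullet> (z - y) \<le> f z\<close>. So only the quadratic term of the model can exceed \<open>f z\<close>, and
  for \<open>z, y \<in> cball x \<epsilon>\<close> it is at most a multiple of \<open>\<epsilon>\<^sup>2\<close> because the Hessians are uniformly
  bounded near \<open>U\<close>. Compactness of the jet gives attainment: a joint maximiser of the model
  expression over \<open>cball x \<epsilon>\<close> times the jet yields a maximiser of the error, so continuity of the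
  model itself is not needed.
\<close>

text \<open>Serves twice: it makes the quadratic term jointly continuous in the Hessian entry and
  the points, and it supplies a constant \<open>k\<close> relating \<open>norm (H *v v)\<close> to
  the norms of \<open>H\<close> and \<open>v\<close>.\<close>

lemma bounded_bilinear_matrix_vector_mult:
  "bounded_bilinear ((*v) :: real ^ 'n ^ 'm \<Rightarrow> real ^ 'n \<Rightarrow> real ^ 'm)"
  unfolding bilinear_conv_bounded_bilinear [symmetric] bilinear_def
  by (intro conjI allI linearI)
    (simp_all add: matrix_vector_right_distrib matrix_vector_mult_add_rdistrib
      matrix_vector_mult_scaleR scaleR_matrix_vector_assoc [symmetric])

lemma GDERIV_grad:
  assumes "f differentiable (at y)"
  shows "GDERIV f y :> grad f y"
proof -
  obtain D where D: "(f has_derivative D) (at y)"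
    using assms by (auto simp: differentiable_def)
  \<comment> \<open>Riesz representation: the functional \<open>D\<close> is the inner product with
    \<open>adjoint D 1\<close>, the only possible gradient, so the \<open>THE\<close> in
    \<open>grad\<close> is well defined.\<close>
  have "D = (\<lambda>h. h \<bullet> adjoint D 1)"
    using adjoint_works [OF has_derivative_linear [OF D], of _ 1] by (intro ext) simp
  then have ex: "GDERIV f y :> adjoint D 1"
    using D unfolding gderiv_def by metis
  have "g = adjoint D 1" if "GDERIV f y :> g" for g
  proof -
    have "h \<bullet> g = h \<bullet> adjoint D 1" for h
      using that ex unfolding gderiv_def by (rule has_derivative_unique [THEN fun_cong])
    then have "\<forall>h. h \<bullet> g = h \<bullet> adjoint D 1"
      by blast
    then show ?thesis
      by (simp only: vector_eq_ldot)
  qed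
  then show ?thesis
    unfolding grad_def by (rule theI [where P = "\<lambda>g. GDERIV f y :> g", OF ex])
qed

text \<open>Restrict \<open>f\<close> to the line through \<open>y\<close> and \<open>z\<close>. The
  restriction is convex with derivative \<open>g \<bullet> (z - y)\<close> at parameter 0, and the
  one-dimensional tangent inequality is read off at parameter 1.\<close>

lemma convex_on_above_tangent:
  fixes f :: "'a::real_inner \<Rightarrow> real"
  assumes conv: "convex_on UNIV f" and D: "GDERIV f y :> g"
  shows "f y + g \<bullet> (z - y) \<le> f z"
proof -
  define l where "l t = y + t *\<^sub>R (z - y)" for t
  have conv_l: "convex_on UNIV (f \<circ> l)"
  proof (rule convex_onI)
    fix t a b :: real assume t: "0 < t" "t < 1"
    have "l ((1 - t) *\<^sub>R a + t *\<^sub>R b) = (1 - t) *\<^sub>R l a + t *\<^sub>R l b"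
      by (simp add: l_def algebra_simps)
    with convex_onD [OF conv, of t "l a" "l b"] t
    show "(f \<circ> l) ((1 - t) *\<^sub>R a + t *\<^sub>R b) \<le> (1 - t) * (f \<circ> l) a + t * (f \<circ> l) b"
      by simp
  qed simp
  have deriv_l: "((f \<circ> l) has_field_derivative g \<bullet> (z - y)) (at 0 within UNIV)"
  proof -
    have "(l has_derivative (\<lambda>t. t *\<^sub>R (z - y))) (at 0)"
      unfolding l_def by (auto intro!: derivative_eq_intros)
    moreover have "(f has_derivative (\<lambda>h. h \<bullet> g)) (at (l 0))"
      using D by (simp add: gderiv_def l_def)
    ultimately have "((f \<circ> l) has_derivative (\<lambda>h. h \<bullet> g) \<circ> (\<lambda>t. t *\<^sub>R (z - y))) (at 0)"
      by (rule diff_chain_at)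
    then show ?thesis
      by (simp add: has_field_derivative_def o_def inner_commute mult_commute_abs)
  qed
  show ?thesis
    using convex_on_imp_above_tangent [OF conv_l connected_UNIV _ UNIV_I deriv_l, of 1]
    by (simp add: l_def)
qed

lemma GDERIV_grad_off_Omega2:
  assumes "y \<notin> Omega2 f"
  shows "GDERIV f y :> grad f y"
  using assms by (intro GDERIV_grad)
    (auto simp: Omega2_def twice_differentiable_at_def dest: eventually_nhds_x_imp_x)

lemma locally_bounded_imp_bounded_on_compact:
  assumes "compact S" and "\<And>x. \<exists>V. open V \<and> x \<in> V \<and> bounded (h ` (V - N))"
  shows "bounded (h ` (S - N))"
proof -
  obtain V where V: "\<And>x. open (V x)" "\<And>x. x \<in> V x" "\<And>x. bounded (h ` (V x - N))"
    using assms(2) by metis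
  obtain T where "finite T" "S \<subseteq> (\<Union>x\<in>T. V x)"
    by (rule compactE_image [OF \<open>compact S\<close>, of S V]) (use V in auto)
  then have "h ` (S - N) \<subseteq> (\<Union>x\<in>T. h ` (V x - N))"
    by blast
  moreover have "bounded (\<Union>x\<in>T. h ` (V x - N))"
    using \<open>finite T\<close> V(3) by auto
  ultimately show ?thesis
    by (rule bounded_subset [rotated])
qed

text \<open>A unit step from \<open>y\<close> along \<open>g y\<close> raises the affine minorant by
  \<open>norm (g y)\<close>, so this norm is at most a difference of two values of \<open>f\<close>
  on a bounded set. It will bound the gradient entries of the jet.\<close>

lemma subgradients_bounded:
  fixes f :: "'a::euclidean_space \<Rightarrow> real"
  assumes cont: "continuous_on UNIV f"
    and sub: "\<And>y z. y \<in> G \<Longrightarrow> f y + g y \<bullet> (z - y) \<le> f z"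
    and "bounded G"
  shows "bounded (g ` G)"
proof -
  obtain B where B: "\<And>y. y \<in> G \<Longrightarrow> norm y \<le> B"
    using \<open>bounded G\<close> by (auto simp: bounded_iff)
  \<comment> \<open>The extra 1 leaves room for the unit step.\<close>
  have "compact (f ` cball 0 (B + 1))"
    by (intro compact_continuous_image continuous_on_subset [OF cont]) auto
  then obtain M where M: "\<And>y. norm y \<le> B + 1 \<Longrightarrow> \<bar>f y\<bar> \<le> M"
    by (force dest!: compact_imp_bounded simp: bounded_iff)
  have "norm (g y) \<le> 2 * M" if y: "y \<in> G" for y
  proof -
    \<comment> \<open>A zero gradient needs no separate treatment here, since
      \<open>sgn 0 = 0\<close>.\<close>
    have "f y + g y \<bullet> (y + sgn (g y) - y) \<le> f (y + sgn (g y))"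
      using y by (rule sub)
    moreover have "g y \<bullet> sgn (g y) = norm (g y)"
      by (cases "g y = 0") (simp_all add: sgn_div_norm dot_square_norm power2_eq_square)
    moreover have "norm (y + sgn (g y)) \<le> B + 1"
      using norm_triangle_ineq [of y "sgn (g y)"] B [OF y] norm_sgn [of "g y"]
      by (simp split: if_splits)
    then have "\<bar>f (y + sgn (g y))\<bar> \<le> M"
      by (rule M)
    moreover have "\<bar>f y\<bar> \<le> M"
      using B [OF y] by (intro M) simp
    ultimately show ?thesis
      by simp
  qed
  then show ?thesis
    by (auto simp: bounded_iff)
qed

text \<open>Closed properties pass from points of twice differentiability to their limits. One
  radius \<delta> > \<epsilon> suffices, because the jet lies in each of the intersected
  closures.\<close>

lemma jet2_subset_closed:
  assumes "\<epsilon> < \<delta>" "closed A"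
    and "\<And>y. y \<in> cball x \<delta> - Omega2 f \<Longrightarrow> (y, f y, grad f y, hess f y) \<in> A"
  shows "jet2 f x \<epsilon> \<subseteq> A"
proof -
  have "closure {(y, f y, grad f y, hess f y) | y. y \<in> cball x \<delta> - Omega2 f} \<subseteq> A"
    using assms by (intro closure_minimal) auto
  then show ?thesis
    using \<open>\<epsilon> < \<delta>\<close> by (auto simp: jet2_def)
qed

text \<open>The closed-set principle gives distance at most \<delta> for every \<delta> >
  \<epsilon>; letting \<delta> decrease to \<epsilon> gives the sharp radius.\<close>

lemma jet2_fst_in_cball:
  fixes f :: "real ^ 'n \<Rightarrow> real"
  assumes "(y, s, \<xi>, H) \<in> jet2 f x \<epsilon>"
  shows "y \<in> cball x \<epsilon>"
proof -
  have "dist x y \<le> \<delta>" if "\<epsilon> < \<delta>" for \<delta>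
  proof -
    have "closed {p :: (real^'n) \<times> real \<times> (real^'n) \<times> (real^'n^'n). dist x (fst p) \<le> \<delta>}"
      by (intro closed_Collect_le continuous_intros)
    from jet2_subset_closed [OF that this, of x f] show ?thesis
      using assms by auto
  qed
  then show ?thesis
    by (auto intro: dense_ge)
qed

text \<open>A null set contains no ball, so some \<open>y\<close> near \<open>x\<close> lies off
  \<open>Omega2 f\<close>, and its own quadruple belongs to every closure.\<close>

lemma jet2_nonempty:
  assumes "negligible (Omega2 f)" "\<epsilon> > 0"
  shows "jet2 f x \<epsilon> \<noteq> {}"
proof -
  have "\<not> ball x \<epsilon> \<subseteq> Omega2 f"
  proof
    assume "ball x \<epsilon> \<subseteq> Omega2 f"
    then have "negligible (ball x \<epsilon>)"
      using assms(1) negligible_subset by blast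
    then show False
      using open_not_negligible [of "ball x \<epsilon>"] \<open>\<epsilon> > 0\<close> by simp
  qed
  then obtain y where "y \<in> ball x \<epsilon>" "y \<notin> Omega2 f"
    by blast
  then have "(y, f y, grad f y, hess f y) \<in> jet2 f x \<epsilon>"
    by (auto simp: jet2_def intro!: closure_subset [THEN subsetD])
  then show ?thesis
    by blast
qed

lemma is_max_unique: "is_max S m \<Longrightarrow> is_max S m' \<Longrightarrow> m = m'"
  by (auto simp: is_max_def intro: antisym)

text \<open>The Hessian bound is required on a radius \<delta> > \<epsilon> because jet entries are
  limits from slightly larger balls. The constant is 1/2 * (C * k) * (2 * \<epsilon>)^2, as 2 *
  \<epsilon> bounds the distance of two points of the ball.\<close>

lemma model_error_attains_max_le:
  fixes f :: "real ^ 'n \<Rightarrow> real"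
  assumes conv: "convex_on UNIV f"
    and negl: "negligible (Omega2 f)"
    and hess: "\<And>y. y \<in> cball x \<delta> - Omega2 f \<Longrightarrow> norm (hess f y) \<le> C"
    and mv: "\<And>(H :: real^'n^'n) v. norm (H *v v) \<le> norm H * norm v * k" "k \<ge> 0"
    and eps: "0 < \<epsilon>" "\<epsilon> < \<delta>"
  shows "\<exists>m. is_max (model_error f x \<epsilon> ` cball x \<epsilon>) m \<and> m \<le> 2 * C * k * \<epsilon>\<^sup>2"
proof -
  have cont: "continuous_on UNIV f"
    using conv by (intro convex_on_continuous) auto
  have cont_fst: "continuous_on UNIV (\<lambda>p :: (real^'n) \<times> 'b::topological_space. f (fst p))"
    by (intro continuous_on_compose2 [OF cont] continuous_intros) auto
  note [continuous_intros] = bounded_bilinear.continuous_on [OF bounded_bilinear_matrix_vector_mult]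
  have sub: "f y + grad f y \<bullet> (z - y) \<le> f z" if "y \<notin> Omega2 f" for y z
    using conv GDERIV_grad_off_Omega2 [OF that] by (rule convex_on_above_tangent)
  let ?J = "jet2 f x \<epsilon>"
  obtain L where L: "\<And>y. y \<in> cball x \<delta> - Omega2 f \<Longrightarrow> norm (grad f y) \<le> L"
  proof -
    have "bounded (grad f ` (cball x \<delta> - Omega2 f))"
      by (rule subgradients_bounded [OF cont]) (auto intro: sub bounded_subset [OF bounded_cball])
    then obtain L where "\<forall>v\<in>grad f ` (cball x \<delta> - Omega2 f). norm v \<le> L"
      unfolding bounded_iff by blast
    then show ?thesis
      by (intro that [of L]) blast
  qed
  \<comment> \<open>By continuity of \<open>f\<close> the value entry stays \<open>f y\<close> in
    the limit. So the pattern \<open>(y, f y, \<xi>, H)\<close> in \<open>model\<close> matches all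
    jet elements.\<close>
  have J_value: "s = f y" if "(y, s, \<xi>, H) \<in> ?J" for y s \<xi> H
  proof -
    have "closed {p :: (real^'n) \<times> real \<times> (real^'n) \<times> (real^'n^'n). fst (snd p) = f (fst p)}"
      by (intro closed_Collect_eq continuous_intros cont_fst)
    from jet2_subset_closed [OF eps(2) this, of x f] show ?thesis
      using that by auto
  qed
  have J_sub: "f y + \<xi> \<bullet> (z - y) \<le> f z" if "(y, s, \<xi>, H) \<in> ?J" for y s \<xi> H z
  proof -
    have "closed {p :: (real^'n) \<times> real \<times> (real^'n) \<times> (real^'n^'n).
            f (fst p) + fst (snd (snd p)) \<bullet> (z - fst p) \<le> f z}"
      by (intro closed_Collect_le continuous_intros cont_fst)
    from jet2_subset_closed [OF eps(2) this, of x f] show ?thesis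
      using that sub by auto
  qed
  have J_hess: "norm H \<le> C" if "(y, s, \<xi>, H) \<in> ?J" for y s \<xi> H
  proof -
    have "closed {p :: (real^'n) \<times> real \<times> (real^'n) \<times> (real^'n^'n). norm (snd (snd (snd p))) \<le> C}"
      by (intro closed_Collect_le continuous_intros)
    from jet2_subset_closed [OF eps(2) this, of x f] show ?thesis
      using that hess by auto
  qed
  have J_compact: "compact ?J"
  proof -
    have "compact (f ` cball x \<delta>)"
      by (intro compact_continuous_image continuous_on_subset [OF cont]) auto
    then have cpt: "compact (cball x \<delta> \<times> f ` cball x \<delta> \<times> cball (0 :: real^'n) L \<times> cball (0 :: real^'n^'n) C)"
      by (intro compact_Times compact_cball)
    have "?J \<subseteq> cball x \<delta> \<times> f ` cball x \<delta> \<times> cball 0 L \<times> cball 0 C"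
      using hess L by (intro jet2_subset_closed [OF eps(2) compact_imp_closed [OF cpt]]) auto
    moreover have "closed ?J"
      by (auto simp: jet2_def)
    ultimately show ?thesis
      using compact_Int_closed [OF cpt, of ?J] by (simp add: Int_absorb1)
  qed
  define \<Phi> where "\<Phi> z j = (case j of (y, s, \<xi>, H) \<Rightarrow>
      f y + \<xi> \<bullet> (z - y) + 1/2 * ((z - y) \<bullet> (H *v (z - y))))"
    for z and j :: "(real^'n) \<times> real \<times> (real^'n) \<times> (real^'n^'n)"
  have model_eq: "model f x \<epsilon> z = m" if "is_max (\<Phi> z ` ?J) m" for z m
  proof -
    have "{f y + \<xi> \<bullet> (z - y) + 1/2 * ((z - y) \<bullet> (H *v (z - y))) | y \<xi> H. (y, f y, \<xi>, H) \<in> ?J}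
        = \<Phi> z ` ?J" (is "?S = _")
    proof (intro equalityI subsetI)
      fix v assume "v \<in> ?S"
      then obtain y \<xi> H where *: "v = \<Phi> z (y, f y, \<xi>, H)" "(y, f y, \<xi>, H) \<in> ?J"
        by (auto simp: \<Phi>_def)
      show "v \<in> \<Phi> z ` ?J"
        unfolding *(1) using *(2) by (rule imageI)
    next
      fix v assume "v \<in> \<Phi> z ` ?J"
      then obtain y s \<xi> H where *: "v = \<Phi> z (y, s, \<xi>, H)" "(y, s, \<xi>, H) \<in> ?J"
        by auto
      then show "v \<in> ?S"
        using J_value [OF *(2)] by (auto simp: \<Phi>_def)
    qed
    then show ?thesis
      unfolding model_def using that by (auto intro: is_max_unique)
  qed
  have \<Phi>_cont: "continuous_on UNIV (\<lambda>p. \<Phi> (fst p) (snd p))"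
    unfolding \<Phi>_def case_prod_beta
    by (intro continuous_intros continuous_on_compose2 [OF cont]) auto
  \<comment> \<open>Attainment at each single \<open>z\<close> gives the \<open>THE\<close> in
    \<open>model\<close> its meaning, so that errors at different points can be compared with the
    joint maximum below.\<close>
  have model_max: "is_max (\<Phi> z ` ?J) (model f x \<epsilon> z)" for z
  proof -
    have "continuous_on ?J (\<lambda>j. \<Phi> (fst (z, j)) (snd (z, j)))"
      by (intro continuous_on_compose2 [OF \<Phi>_cont] continuous_intros) auto
    then obtain j where "j \<in> ?J" "\<forall>i\<in>?J. \<Phi> z i \<le> \<Phi> z j"
      using continuous_attains_sup [OF J_compact jet2_nonempty [OF negl eps(1)]] by force
    then have "is_max (\<Phi> z ` ?J) (\<Phi> z j)"
      by (auto simp: is_max_def)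
    then show ?thesis
      using model_eq by metis
  qed
  let ?E = "\<lambda>p. \<Phi> (fst p) (snd p) - f (fst p)"
  have "continuous_on (cball x \<epsilon> \<times> ?J) ?E"
    by (intro continuous_intros continuous_on_subset [OF \<Phi>_cont] continuous_on_subset [OF cont_fst])
       auto
  moreover have "cball x \<epsilon> \<times> ?J \<noteq> {}"
    using jet2_nonempty [OF negl eps(1)] eps by auto
  ultimately obtain p where p: "p \<in> cball x \<epsilon> \<times> ?J" "\<forall>q\<in>cball x \<epsilon> \<times> ?J. ?E q \<le> ?E p"
    using continuous_attains_sup [OF compact_Times [OF compact_cball J_compact]] by blast
  obtain z y s \<xi> H where p_eq: "p = (z, y, s, \<xi>, H)"
    by (cases p) auto
  define j where "j = (y, s, \<xi>, H)"
  have z: "z \<in> cball x \<epsilon>" and j: "j \<in> ?J"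
    and best: "\<And>w i. w \<in> cball x \<epsilon> \<Longrightarrow> i \<in> ?J \<Longrightarrow> \<Phi> w i - f w \<le> \<Phi> z j - f z"
    using p by (auto simp: p_eq j_def)
  \<comment> \<open>With \<open>z\<close> fixed, \<open>f z\<close> is a constant, so the joint
    maximiser's \<open>j\<close> also maximises \<open>\<Phi> z\<close> over the jet.\<close>
  have "model f x \<epsilon> z = \<Phi> z j"
    using j best [OF z] by (intro model_eq) (auto simp: is_max_def)
  moreover have "model_error f x \<epsilon> w \<le> \<Phi> z j - f z" if "w \<in> cball x \<epsilon>" for w
    using model_max [of w] best [OF that] by (auto simp: is_max_def model_error_def)
  ultimately have "is_max (model_error f x \<epsilon> ` cball x \<epsilon>) (\<Phi> z j - f z)"
    using z by (force simp: is_max_def model_error_def)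
  moreover have "\<Phi> z j - f z \<le> 2 * C * k * \<epsilon>\<^sup>2"
  proof -
    have jJ: "(y, s, \<xi>, H) \<in> ?J"
      using j by (simp add: j_def)
    have "norm (z - y) \<le> 2 * \<epsilon>"
      using jet2_fst_in_cball [OF jJ] z dist_triangle [of z y x]
      by (simp add: dist_norm [symmetric] dist_commute)
    then have sq: "(norm (z - y))\<^sup>2 \<le> (2 * \<epsilon>)\<^sup>2"
      by (intro power_mono) auto
    have "(z - y) \<bullet> (H *v (z - y)) \<le> norm (z - y) * norm (H *v (z - y))"
      by (rule norm_cauchy_schwarz)
    also have "\<dots> \<le> norm (z - y) * (norm H * norm (z - y) * k)"
      by (intro mult_left_mono mv) auto
    also have "\<dots> = norm H * k * (norm (z - y))\<^sup>2"
      by (simp add: power2_eq_square)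
    \<comment> \<open>Monotonicity of the product needs 0 \<le> C, which follows from
      \<open>norm H \<le> C\<close> for the jet element at hand.\<close>
    also have "\<dots> \<le> C * k * (2 * \<epsilon>)\<^sup>2"
      using J_hess [OF jJ] sq mv(2) order_trans [OF norm_ge_zero J_hess [OF jJ]]
      by (intro mult_mono mult_right_mono mult_nonneg_nonneg) auto
    finally have "(z - y) \<bullet> (H *v (z - y)) \<le> 4 * (C * k * \<epsilon>\<^sup>2)"
      by (simp add: power_mult_distrib)
    with J_sub [OF jJ, of z] show ?thesis
      by (simp add: \<Phi>_def j_def)
  qed
  ultimately show ?thesis
    by blast
qed

theorem lemma6:
  fixes f :: "real ^ 'n \<Rightarrow> real"
  assumes "convex_on UNIV f"
    and "locally_lipschitz f"
    and "Omega2 f \<in> null_sets lebesgue"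
    and "\<forall>x. \<exists>V. open V \<and> x \<in> V \<and> bounded (hess f ` (V - Omega2 f))"
  shows "\<forall>U \<epsilon>'. bounded U \<and> \<epsilon>' > 0 \<longrightarrow>
    (\<exists>K>0. \<forall>x\<in>U. \<forall>\<epsilon>\<in>{0<..\<epsilon>'}.
       \<exists>m. is_max (model_error f x \<epsilon> ` cball x \<epsilon>) m \<and> m \<le> K * \<epsilon>\<^sup>2)"
proof (intro allI impI, elim conjE)
  fix U :: "(real ^ 'n) set" and \<epsilon>' :: real
  assume "bounded U" "\<epsilon>' > 0"
  obtain B where B: "\<And>x. x \<in> U \<Longrightarrow> norm x \<le> B"
    using \<open>bounded U\<close> by (auto simp: bounded_iff)
  \<comment> \<open>One radius strictly above every admissible \<epsilon>. All balls of this radius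
    around points of \<open>U\<close> lie in \<open>cball 0 (B + ?\<delta>)\<close>, so
    \<open>C\<close>, and with it \<open>K = 2 * C * k\<close>, depends on neither \<open>x\<close>
    nor \<epsilon>.\<close>
  let ?\<delta> = "\<epsilon>' + 1"
  have "bounded (hess f ` (cball 0 (B + ?\<delta>) - Omega2 f))"
    using assms(4) by (intro locally_bounded_imp_bounded_on_compact) auto
  then obtain C where "C > 0"
    and C: "\<And>y. y \<in> cball 0 (B + ?\<delta>) - Omega2 f \<Longrightarrow> norm (hess f y) \<le> C"
    by (auto simp: bounded_pos)
  obtain k where "k > 0"
    and k: "\<And>(H :: real^'n^'n) v. norm (H *v v) \<le> norm H * norm v * k"
    using bounded_bilinear.pos_bounded [OF bounded_bilinear_matrix_vector_mult] by metis
  have "\<exists>m. is_max (model_error f x \<epsilon> ` cball x \<epsilon>) m \<and> m \<le> 2 * C * k * \<epsilon>\<^sup>2"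
    if "x \<in> U" "\<epsilon> \<in> {0<..\<epsilon>'}" for x \<epsilon>
  proof (rule model_error_attains_max_le [OF assms(1)])
    show "negligible (Omega2 f)"
      using assms(3) by (simp add: negligible_iff_null_sets)
    show "norm (hess f y) \<le> C" if "y \<in> cball x ?\<delta> - Omega2 f" for y
    proof (rule C)
      have "norm y \<le> norm x + dist x y"
        by (metis dist_norm norm_minus_commute norm_triangle_sub)
      then show "y \<in> cball 0 (B + ?\<delta>) - Omega2 f"
        using B [OF \<open>x \<in> U\<close>] that by auto
    qed
  qed (use that k \<open>k > 0\<close> in auto)
  moreover have "2 * C * k > 0"
    using \<open>C > 0\<close> \<open>k > 0\<close> by simp
  ultimately show "\<exists>K>0. \<forall>x\<in>U. \<forall>\<epsilon>\<in>{0<..\<epsilon>'}.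
      \<exists>m. is_max (model_error f x \<epsilon> ` cball x \<epsilon>) m \<and> m \<le> K * \<epsilon>\<^sup>2"
    by blast
qed

end
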